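(* Let $G=(V,E)$ be a finite, simple, connected graph with $n\ge 2$ vertices and $m$ edges, and let $\mu=m-n+1$. Then $$\frac{1}{2}\left(\frac{\mu^2}{n-1}-\mu\right)\le \cap(G).$$
   Context: For a spanning tree $T=(V,E')$ of $G$, edges of $E'$ are tree-edges and edges of $E\setminus E'$ are cycle-edges; $uTv$ is the unique $u$–$v$ path in $T$. A cycle-edge $f=(v,w)$ determines the tree-cycle $vTw\cup\{f\}$. $\cap_G(T)$ is the number of unordered pairs of distinct cycle-edges whose tree-cycles share at least one edge. $\cap(G)$ (the intersection number of $G$) is the minimum of $\cap_G(T)$ over all spanning trees $T$ of $G$. *)

theory Defs
  imports Complex_Main
begin

(* A graph is a vertex set V with a set E of edges, each edge being the 2-element set of
   its ends. AFP Graph_Theory is not used: its notion of forest forbids directed cycles,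
   and the closed walk u, v, u is one in a symmetric digraph, so that there a symmetric
   digraph with at least one arc is never a tree. *)

definition simple_graph :: "'a set \<Rightarrow> 'a set set \<Rightarrow> bool" where
  "simple_graph V E \<longleftrightarrow> finite V \<and> (\<forall>e\<in>E. e \<subseteq> V \<and> card e = 2)"

definition walk :: "'a set \<Rightarrow> 'a set set \<Rightarrow> 'a list \<Rightarrow> bool" where
  "walk V E xs \<longleftrightarrow>
     xs \<noteq> [] \<and> set xs \<subseteq> V \<and> (\<forall>i. Suc i < length xs \<longrightarrow> {xs ! i, xs ! Suc i} \<in> E)"

definition walk_edges :: "'a list \<Rightarrow> 'a set set" where
  "walk_edges xs = {{xs ! i, xs ! Suc i} | i. Suc i < length xs}"

definition path_between :: "'a set \<Rightarrow> 'a set set \<Rightarrow> 'a \<Rightarrow> 'a list \<Rightarrow> 'a \<Rightarrow> bool" where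
  "path_between V E u xs v \<longleftrightarrow> walk V E xs \<and> distinct xs \<and> hd xs = u \<and> last xs = v"

definition connected_graph :: "'a set \<Rightarrow> 'a set set \<Rightarrow> bool" where
  "connected_graph V E \<longleftrightarrow> V \<noteq> {} \<and> (\<forall>u\<in>V. \<forall>v\<in>V. \<exists>xs. path_between V E u xs v)"

definition is_cycle :: "'a set \<Rightarrow> 'a set set \<Rightarrow> 'a list \<Rightarrow> bool" where
  "is_cycle V E xs \<longleftrightarrow> walk V E xs \<and> distinct xs \<and> 3 \<le> length xs \<and> {last xs, hd xs} \<in> E"

definition is_tree :: "'a set \<Rightarrow> 'a set set \<Rightarrow> bool" where
  "is_tree V E \<longleftrightarrow> simple_graph V E \<and> connected_graph V E \<and> (\<nexists>xs. is_cycle V E xs)"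

(* A spanning tree of (V, E) has vertex set V, so it is given by its edge set T. *)
definition spanning_tree :: "'a set \<Rightarrow> 'a set set \<Rightarrow> 'a set set \<Rightarrow> bool" where
  "spanning_tree V E T \<longleftrightarrow> T \<subseteq> E \<and> is_tree V T"

definition tree_path :: "'a set \<Rightarrow> 'a set set \<Rightarrow> 'a \<Rightarrow> 'a \<Rightarrow> 'a list" where
  "tree_path V T u v = (THE xs. path_between V T u xs v)"

(* The edge set of the tree-cycle. Both orderings of the ends of f give the same set, as
   the tree path from w to v is the reverse of the one from v to w. *)
definition tree_cycle :: "'a set \<Rightarrow> 'a set set \<Rightarrow> 'a set \<Rightarrow> 'a set set" where
  "tree_cycle V T f =
     (THE C. \<exists>v w. f = {v, w} \<and> C = walk_edges (tree_path V T v w) \<union> {f})"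

definition tree_intersection_number :: "'a set \<Rightarrow> 'a set set \<Rightarrow> 'a set set \<Rightarrow> nat" where
  "tree_intersection_number V E T =
     card {{f, g} | f g. f \<in> E - T \<and> g \<in> E - T \<and> f \<noteq> g \<and>
                         tree_cycle V T f \<inter> tree_cycle V T g \<noteq> {}}"

definition intersection_number :: "'a set \<Rightarrow> 'a set set \<Rightarrow> nat" where
  "intersection_number V E = Min {tree_intersection_number V E T | T. spanning_tree V E T}"

end

theory Submission
  imports Defs "HOL-Analysis.Convex"
begin

text \<open>Assign to every cycle-edge one tree-edge of its tree-cycle. Cycle-edges with the same
  image have intersecting tree-cycles, and each such pair is counted at only one tree-edge,
  so the intersection number of a spanning tree is at least the sum of \<open>k\<^sub>e choose 2\<close> over its
  \<open>n - 1\<close> edges, where the fibre sizes \<open>k\<^sub>e\<close> add up to \<open>\<mu>\<close>. The bound is then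
  the Cauchy--Schwarz inequality.\<close>

section \<open>Walks and paths\<close>

lemma walk_Nil [simp]: "\<not> walk V E []"
  by (simp add: walk_def)

lemma walk_single [simp]: "walk V E [x] \<longleftrightarrow> x \<in> V"
  by (simp add: walk_def)

lemma walk_Cons2 [simp]:
  "walk V E (x # y # zs) \<longleftrightarrow> x \<in> V \<and> {x, y} \<in> E \<and> walk V E (y # zs)"
proof -
  have "(\<forall>i. Suc i < length (x # y # zs) \<longrightarrow> {(x # y # zs) ! i, (x # y # zs) ! Suc i} \<in> E) \<longleftrightarrow>
    {x, y} \<in> E \<and> (\<forall>i. Suc i < length (y # zs) \<longrightarrow> {(y # zs) ! i, (y # zs) ! Suc i} \<in> E)"
    by (auto simp: less_Suc_eq_0_disj nth_Cons split: nat.split)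
  then show ?thesis by (auto simp: walk_def)
qed

lemma walk_set: "walk V E xs \<Longrightarrow> set xs \<subseteq> V"
  by (simp add: walk_def)

text \<open>The two parts overlap in \<open>a\<close>, so every consecutive pair lies in exactly one
  of them; cutting and gluing walks become a single equivalence.\<close>

lemma walk_append:
  "walk V E (xs @ a # ys) \<longleftrightarrow> walk V E (xs @ [a]) \<and> walk V E (a # ys)"
proof (induction xs)
  case Nil
  then show ?case by (cases ys) auto
next
  case (Cons x xs)
  then show ?case by (cases xs) auto
qed

lemma walk_rev: "walk V E (rev xs) \<longleftrightarrow> walk V E xs"
proof (induction xs)
  case (Cons x xs)
  then show ?case
    by (cases xs) (auto simp: walk_append[of V E "rev _" _ "[_]"] insert_commute dest: walk_set)
qed simp

lemma walk_edges_Cons2: "walk_edges (x # y # zs) = insert {x, y} (walk_edges (y # zs))"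
proof (intro equalityI subsetI)
  fix e assume "e \<in> walk_edges (x # y # zs)"
  then obtain i where "Suc i < length (x # y # zs)" "e = {(x # y # zs) ! i, (x # y # zs) ! Suc i}"
    by (auto simp: walk_edges_def)
  then show "e \<in> insert {x, y} (walk_edges (y # zs))"
    by (cases i) (auto simp: walk_edges_def)
next
  fix e assume "e \<in> insert {x, y} (walk_edges (y # zs))"
  then consider "e = {x, y}" | i where "Suc i < length (y # zs)" "e = {(y # zs) ! i, (y # zs) ! Suc i}"
    by (auto simp: walk_edges_def)
  then show "e \<in> walk_edges (x # y # zs)"
  proof cases
    case 1
    then show ?thesis by (auto simp: walk_edges_def intro: exI[of _ 0])
  next
    case 2
    then show ?thesis unfolding walk_edges_def by (intro CollectI exI[of _ "Suc i"]) auto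
  qed
qed

lemma walk_edges_rev: "walk_edges (rev xs) = walk_edges xs"
proof -
  have sub: "walk_edges (rev ys) \<subseteq> walk_edges ys" for ys :: "'a list"
  proof
    fix e assume "e \<in> walk_edges (rev ys)"
    then obtain i where i: "Suc i < length ys" "e = {rev ys ! i, rev ys ! Suc i}"
      by (auto simp: walk_edges_def)
    \<comment> \<open>Reversal sends the positions \<open>i\<close>, \<open>Suc i\<close> to
      \<open>Suc j\<close>, \<open>j\<close>, so the same two vertices are met in the opposite
      order.\<close>
    define j where "j = length ys - Suc (Suc i)"
    have "Suc j < length ys" "rev ys ! i = ys ! Suc j" "rev ys ! Suc i = ys ! j"
      using i by (auto simp: j_def rev_nth Suc_diff_Suc)
    then show "e \<in> walk_edges ys" using i by (auto simp: walk_edges_def)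
  qed
  show ?thesis using sub[of xs] sub[of "rev xs"] by simp
qed

lemma path_between_rev: "path_between V E u xs v \<Longrightarrow> path_between V E v (rev xs) u"
  by (auto simp: path_between_def walk_rev hd_rev last_rev)

lemma path_between_suffix:
  assumes "path_between V E u (xs @ a # ys) v"
  shows "path_between V E a (a # ys) v"
  using assms walk_append[of V E xs a ys] by (auto simp: path_between_def)

lemma path_between_Cons:
  assumes "path_between V E a xs v" "u \<in> V" "{u, a} \<in> E" "u \<notin> set xs"
  shows "path_between V E u (u # xs) v"
  using assms by (cases xs) (auto simp: path_between_def)

lemma path_between_nonempty: "path_between V E u xs v \<Longrightarrow> xs \<noteq> []"
  by (auto simp: path_between_def)

lemma path_between_refl: "path_between V E u xs u \<Longrightarrow> xs = [u]"
  by (cases xs) (auto simp: path_between_def split: if_splits)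

text \<open>If two paths from \<open>u\<close> leave along different edges, follow the first up to the first vertex
  \<open>a\<close> that lies on the second, and return to \<open>u\<close> along the second.\<close>

lemma acyclic_path_unique:
  assumes acyc: "\<nexists>xs. is_cycle V E xs"
  shows "path_between V E u xs v \<Longrightarrow> path_between V E u ys v \<Longrightarrow> xs = ys"
proof (induction xs arbitrary: u ys)
  case Nil
  then show ?case by (simp add: path_between_def)
next
  case (Cons x xs)
  have x: "x = u" using Cons.prems by (simp add: path_between_def)
  show ?case
  proof (cases "u = v")
    case True
    then show ?thesis using Cons.prems path_between_refl by metis
  next
    case False
    obtain b xs' where xs: "xs = b # xs'"
      using Cons.prems(1) False x by (cases xs) (auto simp: path_between_def)
    obtain c ys' where ys: "ys = u # c # ys'"
      using Cons.prems(2) False by (cases ys; cases "tl ys") (auto simp: path_between_def)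
    have p: "path_between V E b xs v" "path_between V E c (c # ys') v"
      using Cons.prems path_between_suffix[of V E u "[u]"] by (auto simp: xs ys x)
    show ?thesis
    proof (cases "b = c")
      case True
      then show ?thesis using Cons.IH[OF p(1), of "c # ys'"] p(2) x ys by simp
    next
      case False
      have "v \<in> set xs" "v \<in> set (c # ys')"
        using p by (metis path_between_def path_between_nonempty last_in_set)+
      then have "\<exists>z\<in>set xs. z \<in> set (c # ys')" by blast
      then obtain xs1 a xs2 where s1: "xs = xs1 @ a # xs2" "a \<in> set (c # ys')"
          "\<forall>z\<in>set xs1. z \<notin> set (c # ys')"
        by (elim split_list_first_propE) blast
      obtain ys1 ys2 where s2: "c # ys' = ys1 @ a # ys2" "a \<notin> set ys1"
        using s1(2) by (meson split_list_first)
      have w1: "walk V E ((u # xs1) @ a # xs2)"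
        using Cons.prems by (auto simp: path_between_def x ys s1(1) s2(1))
      have d: "distinct (u # xs1 @ a # xs2)" "distinct (u # ys1 @ a # ys2)"
        using Cons.prems by (auto simp: path_between_def x ys s1(1) s2(1))
      have "walk V E (ys1 @ a # ys2)"
        using p(2) by (simp add: path_between_def s2(1))
      then have "walk V E (ys1 @ [a])" using walk_append by metis
      then have w3: "walk V E (a # rev ys1)" using walk_rev[of V E "ys1 @ [a]"] by simp
      have w: "walk V E ((u # xs1) @ a # rev ys1)"
        using w1 w3 walk_append by metis
      have "set xs1 \<inter> set ys1 = {}"
        using s1(3) s2(1) by (metis UnCI disjoint_iff set_append)
      then have dist: "distinct ((u # xs1) @ a # rev ys1)"
        using d by auto
      \<comment> \<open>Otherwise \<open>a\<close> would be both \<open>b\<close> and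
        \<open>c\<close>. Hence the closed walk has a third vertex besides \<open>u\<close> and
        \<open>a\<close>.\<close>
      have "\<not> (xs1 = [] \<and> ys1 = [])"
        using False s1(1) s2(1) xs by auto
      then have len: "3 \<le> length ((u # xs1) @ a # rev ys1)"
        by (cases xs1; cases ys1) auto
      \<comment> \<open>If \<open>ys1\<close> is empty, then \<open>a = c\<close>. In either case
        the closing edge is the first edge \<open>{u, c}\<close> of the second path.\<close>
      have "last (a # rev ys1) = c"
        using s2(1) by (cases ys1) auto
      moreover have "{u, c} \<in> E"
        using Cons.prems(2) by (simp add: path_between_def ys)
      ultimately have "is_cycle V E ((u # xs1) @ a # rev ys1)"
        using w dist len by (simp add: is_cycle_def insert_commute)
      then show ?thesis using acyc by blast
    qed
  qed
qed

section \<open>Trees\<close>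

lemma is_tree_pathE:
  assumes "is_tree V T" "u \<in> V" "v \<in> V"
  obtains xs where "path_between V T u xs v"
  using assms unfolding is_tree_def connected_graph_def by blast

lemma is_tree_path_unique:
  "is_tree V T \<Longrightarrow> path_between V T u xs v \<Longrightarrow> path_between V T u ys v \<Longrightarrow> xs = ys"
  using acyclic_path_unique unfolding is_tree_def by metis

lemma tree_path_eq:
  "is_tree V T \<Longrightarrow> path_between V T u xs v \<Longrightarrow> tree_path V T u v = xs"
  unfolding tree_path_def using is_tree_path_unique by (metis the_equality)

lemma path_between_tree_path:
  "is_tree V T \<Longrightarrow> u \<in> V \<Longrightarrow> v \<in> V \<Longrightarrow> path_between V T u (tree_path V T u v) v"
  using is_tree_pathE tree_path_eq by metis

lemma tree_path_rev:
  assumes "is_tree V T" "u \<in> V" "v \<in> V"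
  shows "tree_path V T v u = rev (tree_path V T u v)"
  using assms by (intro tree_path_eq path_between_rev path_between_tree_path)

text \<open>By uniqueness the tail of a tree path is again a tree path, so one step towards
  \<open>v\<close> shortens the path by exactly one vertex.\<close>

lemma tree_path_neq:
  assumes "is_tree V T" "u \<in> V" "v \<in> V" "u \<noteq> v"
  obtains w ys where "tree_path V T u v = u # w # ys" "{u, w} \<in> T" "tree_path V T w v = w # ys"
    "u \<notin> set (w # ys)"
proof -
  have p: "path_between V T u (tree_path V T u v) v"
    using assms path_between_tree_path by metis
  then obtain w ys where eq: "tree_path V T u v = u # w # ys"
    using assms(4) by (cases "tree_path V T u v"; cases "tl (tree_path V T u v)")
      (auto simp: path_between_def)
  have "path_between V T w (w # ys) v"
    using p path_between_suffix[of V T u "[u]"] by (simp add: eq)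
  then have "tree_path V T w v = w # ys"
    using assms(1) tree_path_eq by metis
  moreover have "{u, w} \<in> T" "u \<notin> set (w # ys)"
    using p by (auto simp: path_between_def eq)
  ultimately show ?thesis using that eq by blast
qed

text \<open>The description behind \<open>THE\<close> is unique: the only other naming of the ends
  swaps them, which reverses the path and keeps its edges.\<close>

lemma tree_cycle_eq:
  assumes "is_tree V T" "v \<in> V" "w \<in> V"
  shows "tree_cycle V T {v, w} = walk_edges (tree_path V T v w) \<union> {{v, w}}"
  unfolding tree_cycle_def
proof (rule the_equality)
  fix C assume "\<exists>v' w'. {v, w} = {v', w'} \<and> C = walk_edges (tree_path V T v' w') \<union> {{v, w}}"
  then show "C = walk_edges (tree_path V T v w) \<union> {{v, w}}"
    using assms by (auto simp: doubleton_eq_iff tree_path_rev[of V T w v] walk_edges_rev)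
qed blast

text \<open>The ends of \<open>f\<close> differ, so the tree path joining them has a first edge.
  This allows a tree-edge to be assigned to each cycle-edge.\<close>

lemma tree_cycle_meets_tree:
  assumes T: "is_tree V T" and f: "f \<subseteq> V" "card f = 2"
  shows "tree_cycle V T f \<inter> T \<noteq> {}"
proof -
  obtain v w where vw: "f = {v, w}" "v \<noteq> w" using f(2) by (meson card_2_iff)
  then have V: "v \<in> V" "w \<in> V" using f(1) by auto
  obtain x ys where "tree_path V T v w = v # x # ys" "{v, x} \<in> T"
    using tree_path_neq[OF T V vw(2)] by metis
  then have "{v, x} \<in> tree_cycle V T f"
    by (simp add: vw tree_cycle_eq[OF T V] walk_edges_Cons2)
  then show ?thesis using \<open>{v, x} \<in> T\<close> by blast
qed

text \<open>Root the tree at \<open>r\<close>: mapping every other vertex to the first edge of its path to \<open>r\<close> is a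
  bijection onto the edges.\<close>

lemma card_tree_edges:
  assumes T: "is_tree V T"
  shows "card V = Suc (card T)"
proof -
  have fin: "finite V" and sub: "\<And>e. e \<in> T \<Longrightarrow> e \<subseteq> V \<and> card e = 2"
    using T by (auto simp: is_tree_def simple_graph_def)
  obtain r where r: "r \<in> V" using T by (auto simp: is_tree_def connected_graph_def)
  define p where "p u = tree_path V T u r" for u
  \<comment> \<open>Index 1 is the vertex after \<open>u\<close> on its way to the root; it exists
    only for \<open>u \<noteq> r\<close>, as the path of \<open>r\<close> is
    \<open>[r]\<close>.\<close>
  define e where "e u = {u, p u ! 1}" for u
  have step: "\<exists>w ys. p u = u # w # ys \<and> e u = {u, w} \<and> {u, w} \<in> T \<and> p w = w # ys"
    if "u \<in> V - {r}" for u
    using tree_path_neq[OF T _ r, of u] that unfolding p_def e_def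
    by (metis DiffD1 DiffD2 One_nat_def insertI1 nth_Cons_0 nth_Cons_Suc)
  have path: "path_between V T u (p u) r" if "u \<in> V" for u
    using path_between_tree_path[OF T that r] by (simp add: p_def)
  have uniq: "path_between V T u xs r \<Longrightarrow> p u = xs" for u xs
    using tree_path_eq[OF T] by (simp add: p_def)
  have "inj_on e (V - {r})"
  proof (rule inj_onI, rule ccontr)
    fix u v assume uv: "u \<in> V - {r}" "v \<in> V - {r}" "e u = e v" "u \<noteq> v"
    obtain w ys where w: "p u = u # w # ys" "e u = {u, w}" "p w = w # ys"
      using step[OF uv(1)] by blast
    obtain x zs where x: "p v = v # x # zs" "e v = {v, x}" "p x = x # zs"
      using step[OF uv(2)] by blast
    \<comment> \<open>Each of the two vertices would be the successor of the other, making each path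
      longer than the other.\<close>
    have "w = v" "x = u" using uv(3,4) w(2) x(2) by (auto simp: doubleton_eq_iff)
    then have "length (p u) = Suc (length (p v))" "length (p v) = Suc (length (p u))"
      using w x by auto
    then show False by simp
  qed
  moreover have "e ` (V - {r}) = T"
  proof (intro equalityI subsetI)
    fix f assume "f \<in> e ` (V - {r})"
    then show "f \<in> T" using step by fastforce
  next
    \<comment> \<open>Prepending \<open>u\<close> to the path of \<open>v\<close> gives the path of
      \<open>u\<close>, whose first edge is then \<open>{u, v}\<close>; and
      \<open>u \<noteq> r\<close> because \<open>r\<close> lies on the path of
      \<open>v\<close>.\<close>
    have first: "{u, v} \<in> e ` (V - {r})" if "{u, v} \<in> T" "u \<in> V" "v \<in> V" "u \<notin> set (p v)" for u v
    proof -
      have "path_between V T u (u # p v) r"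
        using path_between_Cons path that by metis
      then have "p u = u # p v" by (rule uniq)
      moreover have "p v ! 0 = v"
        using path[OF that(3)] by (cases "p v") (auto simp: path_between_def)
      ultimately have "e u = {u, v}" by (simp add: e_def)
      moreover have "u \<noteq> r"
        using that(4) path[OF that(3)] by (metis path_between_def path_between_nonempty last_in_set)
      ultimately show ?thesis using that(2) by blast
    qed
    fix f assume f: "f \<in> T"
    then obtain u v where uv: "f = {u, v}" "u \<noteq> v" using sub by (meson card_2_iff)
    then have V: "u \<in> V" "v \<in> V" using sub[OF f] by auto
    show "f \<in> e ` (V - {r})"
    \<comment> \<open>One end always avoids the root path of the other: if \<open>v\<close> lies on
      the path of \<open>u\<close>, the path of \<open>v\<close> is a proper suffix of it, free of
      \<open>u\<close>.\<close>
    proof (cases "v \<in> set (p u)")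
      case True
      then obtain xs ys where s: "p u = xs @ v # ys" by (meson split_list)
      have "p v = v # ys"
        using path[OF V(1)] path_between_suffix uniq s by metis
      moreover have "xs \<noteq> [] \<and> hd xs = u \<and> distinct (p u)"
        using path[OF V(1)] uv(2) s by (cases xs) (auto simp: path_between_def)
      ultimately have "u \<notin> set (p v)"
        using s by (cases xs) auto
      then show ?thesis using first[of u v] f V uv by simp
    next
      case False
      then show ?thesis using first[of v u] f V uv by (simp add: insert_commute)
    qed
  qed
  ultimately have "card (V - {r}) = card T" using card_image by metis
  then show ?thesis using r fin by (metis card_Suc_Diff1)
qed

section \<open>Existence of spanning trees\<close>

text \<open>Reachability in this relation replaces lists by a reflexive-transitive closure when
  edges are deleted. Both ends are kept in \<open>V\<close> because \<open>E\<close> is arbitrary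
  here.\<close>

definition adj :: "'a set \<Rightarrow> 'a set set \<Rightarrow> ('a \<times> 'a) set" where
  "adj V E = {(a, b). a \<in> V \<and> b \<in> V \<and> {a, b} \<in> E}"

lemma sym_adj: "sym (adj V E)"
  by (auto simp: sym_def adj_def insert_commute)

lemma walk_imp_reachable: "walk V E xs \<Longrightarrow> (hd xs, last xs) \<in> (adj V E)\<^sup>*"
proof (induction xs rule: induct_list012)
  case (3 x y zs)
  then have "(x, y) \<in> adj V E" using walk_set[of V E "y # zs"] by (auto simp: adj_def)
  then show ?case using 3 by (auto intro: converse_rtrancl_into_rtrancl)
qed auto

lemma reachable_imp_path:
  assumes "(u, v) \<in> (adj V E)\<^sup>*" "v \<in> V"
  shows "\<exists>xs. path_between V E u xs v"
  using assms(1)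
proof (induction rule: converse_rtrancl_induct)
  case base
  have "path_between V E v [v] v" using assms(2) by (simp add: path_between_def)
  then show ?case by blast
next
  case (step u a)
  then obtain xs where xs: "path_between V E a xs v" by blast
  show ?case
  \<comment> \<open>A repeated vertex is removed by a shortcut: the suffix starting at
    \<open>u\<close> is already a path from \<open>u\<close>.\<close>
  proof (cases "u \<in> set xs")
    case True
    then show ?thesis using xs path_between_suffix by (metis split_list)
  next
    case False
    then show ?thesis using path_between_Cons[OF xs] step(1) by (auto simp: adj_def)
  qed
qed

lemma connected_graph_iff_reachable:
  "connected_graph V E \<longleftrightarrow> V \<noteq> {} \<and> (\<forall>u\<in>V. \<forall>v\<in>V. (u, v) \<in> (adj V E)\<^sup>*)"
  using walk_imp_reachable reachable_imp_path unfolding connected_graph_def path_between_def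
  by metis

text \<open>The rest of the cycle is a detour around the deleted closing edge.\<close>

lemma connected_graph_delete_cycle_edge:
  assumes conn: "connected_graph V E" and cyc: "is_cycle V E xs"
  shows "connected_graph V (E - {{last xs, hd xs}})"
proof -
  let ?E = "E - {{last xs, hd xs}}"
  have xs: "walk V E xs" "distinct xs" "3 \<le> length xs" using cyc by (auto simp: is_cycle_def)
  then have ne: "xs \<noteq> []" by auto
  \<comment> \<open>With at least three distinct vertices, the first and the last are not
    consecutive in the list, so the detour avoids the deleted edge.\<close>
  have "{xs ! i, xs ! Suc i} \<noteq> {last xs, hd xs}" if "Suc i < length xs" for i
    using xs(2,3) that ne
    by (auto simp: doubleton_eq_iff last_conv_nth hd_conv_nth nth_eq_iff_index_eq)
  then have "walk V ?E xs" using xs(1) by (simp add: walk_def)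
  then have "(hd xs, last xs) \<in> (adj V ?E)\<^sup>*" by (rule walk_imp_reachable)
  moreover from this have "(last xs, hd xs) \<in> (adj V ?E)\<^sup>*"
    using sym_rtrancl[OF sym_adj] by (metis symD)
  moreover have "adj V E \<subseteq> adj V ?E \<union> {(hd xs, last xs), (last xs, hd xs)}"
    by (auto simp: adj_def doubleton_eq_iff)
  ultimately have "adj V E \<subseteq> (adj V ?E)\<^sup>*" by blast
  then have "(adj V E)\<^sup>* \<subseteq> (adj V ?E)\<^sup>*" by (rule rtrancl_subset_rtrancl)
  then show ?thesis using conn by (auto simp: connected_graph_iff_reachable)
qed

lemma simple_graph_finite_edges: "simple_graph V E \<Longrightarrow> finite E"
  by (rule finite_subset[of _ "Pow V"]) (auto simp: simple_graph_def)

text \<open>An inclusion-minimal connected edge set is acyclic, since an edge of a cycle could be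
  deleted from it.\<close>

lemma spanning_tree_exists:
  assumes "simple_graph V E" "connected_graph V E"
  shows "\<exists>T. spanning_tree V E T"
proof -
  let ?S = "{T. T \<subseteq> E \<and> connected_graph V T}"
  have fin: "finite ?S" using simple_graph_finite_edges[OF assms(1)] by simp
  have "E \<in> ?S" using assms(2) by simp
  from finite_has_minimal2[OF fin this]
  obtain T where T: "T \<in> ?S" and minimal: "\<forall>T'\<in>?S. T' \<subseteq> T \<longrightarrow> T = T'"
    by (elim bexE conjE)
  have "\<not> is_cycle V T xs" for xs
  proof
    assume cyc: "is_cycle V T xs"
    then have "T - {{last xs, hd xs}} \<in> ?S"
      using connected_graph_delete_cycle_edge[OF _ cyc] T by auto
    with minimal have "T = T - {{last xs, hd xs}}" by (elim ballE impE) auto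
    then show False using cyc unfolding is_cycle_def by blast
  qed
  moreover have "simple_graph V T" using assms(1) T by (auto simp: simple_graph_def)
  ultimately show ?thesis using T by (auto simp: spanning_tree_def is_tree_def)
qed

section \<open>Counting pairs\<close>

text \<open>The counting argument freed from graphs: \<open>c\<close> colours \<open>F\<close> by
  elements of \<open>T\<close>, and \<open>P\<close> is any finite set containing the monochromatic
  pairs.\<close>

lemma monochromatic_pairs_bound:
  fixes c :: "'b \<Rightarrow> 'c"
  assumes F: "finite F" and T: "finite T" and c: "c ` F \<subseteq> T"
    and P: "finite P" "\<And>f g. f \<in> F \<Longrightarrow> g \<in> F \<Longrightarrow> f \<noteq> g \<Longrightarrow> c f = c g \<Longrightarrow> {f, g} \<in> P"
  shows "1 / 2 * ((real (card F))\<^sup>2 / real (card T) - real (card F)) \<le> real (card P)"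
\<comment> \<open>Division by zero gives 0, so for empty \<open>T\<close> the left side is at most
  0.\<close>
proof (cases "T = {}")
  case True
  then show ?thesis by simp
next
  case False
  define K where "K e = {f \<in> F. c f = e}" for e
  define k where "k e = real (card (K e))" for e
  have finK: "finite (K e)" for e using F by (simp add: K_def)
  have "card F = card (\<Union>e\<in>T. K e)"
    using c by (intro arg_cong[where f = card]) (auto simp: K_def)
  also have "\<dots> = (\<Sum>e\<in>T. card (K e))"
    by (rule card_UN_disjoint) (use T finK in \<open>auto simp: K_def\<close>)
  finally have sumk: "(\<Sum>e\<in>T. k e) = real (card F)" by (simp add: k_def)
  have "(\<Sum>e\<in>T. card (K e) choose 2) = (\<Sum>e\<in>T. card {A. A \<subseteq> K e \<and> card A = 2})"
    using finK by (simp add: n_subsets)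
  also have "\<dots> = card (\<Union>e\<in>T. {A. A \<subseteq> K e \<and> card A = 2})"
  proof (rule card_UN_disjoint[symmetric])
    \<comment> \<open>A two-element set is nonempty, and any member of it determines the colour
      class.\<close>
    show "\<forall>e\<in>T. \<forall>e'\<in>T. e \<noteq> e' \<longrightarrow>
        {A. A \<subseteq> K e \<and> card A = 2} \<inter> {A. A \<subseteq> K e' \<and> card A = 2} = {}"
      by (auto simp: K_def card_2_iff)
  qed (use T finK in auto)
  also have "\<dots> \<le> card P"
    using P by (intro card_mono) (auto simp: K_def card_2_iff)
  finally have "real (\<Sum>e\<in>T. card (K e) choose 2) \<le> real (card P)"
    by (simp only: of_nat_le_iff)
  moreover have "real (a choose 2) = 1 / 2 * ((real a)\<^sup>2 - real a)" for a
    by (induction a) (simp_all add: numeral_2_eq_2 algebra_simps)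
  \<comment> \<open>The linear terms of the binomials add up to \<open>card F\<close>, leaving the
    sum of squares.\<close>
  ultimately have "1 / 2 * ((\<Sum>e\<in>T. (k e)\<^sup>2) - real (card F)) \<le> real (card P)"
    by (simp add: k_def sum_subtractf flip: sumk sum_divide_distrib)
  moreover have "(real (card F))\<^sup>2 / real (card T) \<le> (\<Sum>e\<in>T. (k e)\<^sup>2)"
    using sum_squared_le_sum_of_squares[of k T] False T
    by (simp add: sumk divide_le_eq mult.commute card_gt_0_iff)
  ultimately show ?thesis by simp
qed

lemma tree_intersection_number_bound:
  assumes G: "simple_graph V E" and T: "spanning_tree V E T"
  defines "\<mu> \<equiv> real (card E) - real (card V) + 1"
  shows "1 / 2 * (\<mu>\<^sup>2 / (real (card V) - 1) - \<mu>) \<le> real (tree_intersection_number V E T)"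
proof -
  have tree: "is_tree V T" and sub: "T \<subseteq> E" using T by (auto simp: spanning_tree_def)
  have finE: "finite E" using G by (rule simple_graph_finite_edges)
  then have finT: "finite T" using sub finite_subset by blast
  have n: "card V = Suc (card T)" using tree by (rule card_tree_edges)
  \<comment> \<open>A spanning tree has \<open>n - 1\<close> edges, so \<open>\<mu>\<close> counts
    its cycle-edges, whichever tree is taken.\<close>
  have \<mu>: "\<mu> = real (card (E - T))"
    using n sub finT finE by (simp add: \<mu>_def card_Diff_subset card_mono of_nat_diff)
  define c where "c f = (SOME e. e \<in> tree_cycle V T f \<inter> T)" for f
  have c: "c f \<in> tree_cycle V T f \<inter> T" if "f \<in> E - T" for f
  proof -
    have "tree_cycle V T f \<inter> T \<noteq> {}"
      using tree_cycle_meets_tree[OF tree] G that sub by (auto simp: simple_graph_def)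
    then show ?thesis unfolding c_def using some_in_eq by metis
  qed
  let ?P = "{{f, g} | f g. f \<in> E - T \<and> g \<in> E - T \<and> f \<noteq> g \<and>
    tree_cycle V T f \<inter> tree_cycle V T g \<noteq> {}}"
  have "1 / 2 * ((real (card (E - T)))\<^sup>2 / real (card T) - real (card (E - T))) \<le> real (card ?P)"
  proof (rule monochromatic_pairs_bound[where c = c])
    show "finite ?P" by (rule finite_subset[of _ "Pow E"]) (use finE in auto)
    \<comment> \<open>The common value of \<open>c\<close> is an edge of both tree-cycles.\<close>
    show "{f, g} \<in> ?P" if "f \<in> E - T" "g \<in> E - T" "f \<noteq> g" "c f = c g" for f g
      using that c[of f] c[of g] by fastforce
  qed (use finE finT c in auto)
  then show ?thesis by (simp add: \<mu> n tree_intersection_number_def)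
qed

theorem theorem2:
  fixes V :: "'a set" and E :: "'a set set" and n m :: nat and \<mu> :: real
  assumes "simple_graph V E"
    and "connected_graph V E"
    and "n = card V" and "n \<ge> 2"
    and "m = card E"
    and "\<mu> = real m - real n + 1"
  shows "1 / 2 * (\<mu>\<^sup>2 / (real n - 1) - \<mu>) \<le> real (intersection_number V E)"
proof -
  let ?S = "{tree_intersection_number V E T | T. spanning_tree V E T}"
  \<comment> \<open>\<open>Min\<close> is attained only on a finite nonempty set. Finiteness holds
    because spanning trees are subsets of \<open>E\<close>; the bound then applies to a minimizing
    tree.\<close>
  have "?S \<subseteq> tree_intersection_number V E ` Pow E" by (auto simp: spanning_tree_def)
  then have "finite ?S"
    using simple_graph_finite_edges[OF assms(1)] by (meson finite_Pow_iff finite_imageI finite_subset)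
  moreover have "?S \<noteq> {}" using spanning_tree_exists[OF assms(1,2)] by blast
  ultimately have "intersection_number V E \<in> ?S"
    unfolding intersection_number_def by (rule Min_in)
  then show ?thesis
    using tree_intersection_number_bound[OF assms(1)] assms(3,5,6) by auto
qed

end
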